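(* Let $q$ be a prime power, $m\ge1$ an integer, and $f_2,\dots,f_{m+1}\in\mathbb{F}_q[x]$ polynomials such that the map $\vartheta:\mathbb{F}_q\to\mathbb{F}_q^{m+1}$, $u\mapsto(1,f_2(u),\dots,f_{m+1}(u))$, is injective. Let $\mathfrak{G}$ be the bipartite graph whose vertex set is the disjoint union of a point set $\mathfrak{P}=\mathbb{F}_q^{m+1}$ and a line set $\mathfrak{L}=\mathbb{F}_q^{m+1}$, in which a point $P=(p_1,\dots,p_{m+1})$ is adjacent to a line $L=[l_1,\dots,l_{m+1}]$ if and only if $l_k+p_k=f_k(p_1)\,l_1$ for all $k=2,\dots,m+1$. For $w=(w_1,\dots,w_{m+1})\in\mathbb{F}_q^{m+1}$ put $F_w(u)=w_1+w_2f_2(u)+\cdots+w_{m+1}f_{m+1}(u)$ and $N_{F_w}=|\{u\in\mathbb{F}_q: F_w(u)=0\}|$. Then the eigenvalues of the adjacency matrix of $\mathfrak{G}$, counted with multiplicity, are $\pm\sqrt{qN_{F_w}}$ for $w$ ranging over $\mathbb{F}_q^{m+1}$; i.e., for $0\le i\le q$ the multiplicity of each of $\pm\sqrt{qi}$ is $n_i=|\{w\in\mathbb{F}_q^{m+1}: N_{F_w}=i\}|$. Moreover, the number of connected components of $\mathfrak{G}$ is $q^{\,m+1-r}$, where $r$ is the rank over $\mathbb{F}_q$ of the functions $1,f_2,\dots,f_{m+1}$ (viewed as functions $\mathbb{F}_q\to\mathbb{F}_q$); in particular $\mathfrak{G}$ is connected if and only if $1,f_2,\dots,f_{m+1}$ are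 $\mathbb{F}_q$-linearly independent.
   Context: The graph has $2q^{m+1}$ vertices; eigenvalues are those of its $2q^{m+1}\times 2q^{m+1}$ adjacency matrix. Linear independence/rank of $1,f_2,\dots,f_{m+1}$ refers to them as functions on $\mathbb{F}_q$ (a combination $w_1+\sum w_kf_k$ is zero iff it vanishes at every $x\in\mathbb{F}_q$). *)

theory Defs
  imports
    "Jordan_Normal_Form.Char_Poly"
    "Graph_Theory.Graph_Theory"
    "HOL-Library.Cardinality"
    "HOL-Library.FuncSet"
    "HOL-Library.Function_Algebras"
begin

text \<open>
  The field \<open>\<bbbF>\<^sub>q\<close> is a type \<open>'a :: {field, finite}\<close> with \<open>q = CARD('a)\<close>. A vector
  in \<open>\<bbbF>\<^sub>q\<^sup>m\<^sup>+\<^sup>1\<close> is an extensional function on the index set \<open>{1..m+1}\<close>.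
  The polynomials are given by \<open>f :: nat \<Rightarrow> 'a poly\<close>, of which only \<open>f 2, \<dots>, f (m+1)\<close>
  are used.
\<close>

definition coords :: "nat \<Rightarrow> (nat \<Rightarrow> 'a) set" where
  "coords m = {1..m+1} \<rightarrow>\<^sub>E UNIV"

definition coord_fun :: "(nat \<Rightarrow> 'a::comm_semiring_1 poly) \<Rightarrow> nat \<Rightarrow> 'a \<Rightarrow> 'a" where
  "coord_fun f k = (if k = 1 then (\<lambda>u. 1) else poly (f k))"

definition vartheta :: "nat \<Rightarrow> (nat \<Rightarrow> 'a::comm_semiring_1 poly) \<Rightarrow> 'a \<Rightarrow> (nat \<Rightarrow> 'a)" where
  "vartheta m f u = (\<lambda>k\<in>{1..m+1}. coord_fun f k u)"

definition incident ::
    "nat \<Rightarrow> (nat \<Rightarrow> 'a::comm_semiring_1 poly) \<Rightarrow> (nat \<Rightarrow> 'a) \<Rightarrow> (nat \<Rightarrow> 'a) \<Rightarrow> bool" where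
  "incident m f p l \<longleftrightarrow> (\<forall>k\<in>{2..m+1}. l k + p k = poly (f k) (p 1) * l 1)"

text \<open>
  Undirected graphs are symmetric digraphs, as in \<^theory>\<open>Graph_Theory.Digraph\<close>. Points are
  tagged with \<^const>\<open>Inl\<close> and lines with \<^const>\<open>Inr\<close>.
\<close>

definition incidence_graph ::
    "nat \<Rightarrow> (nat \<Rightarrow> 'a::comm_semiring_1 poly) \<Rightarrow> ((nat \<Rightarrow> 'a) + (nat \<Rightarrow> 'a)) pair_pre_digraph" where
  "incidence_graph m f =
    \<lparr> pverts = coords m <+> coords m,
      parcs = {(Inl p, Inr l) | p l. p \<in> coords m \<and> l \<in> coords m \<and> incident m f p l}
            \<union> {(Inr l, Inl p) | p l. p \<in> coords m \<and> l \<in> coords m \<and> incident m f p l} \<rparr>"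

lemma finite_coords: "finite (coords m :: (nat \<Rightarrow> 'a::finite) set)"
  by (simp add: coords_def finite_PiE)

lemma card_coords: "card (coords m :: (nat \<Rightarrow> 'a::finite) set) = CARD('a) ^ (m + 1)"
  by (simp add: coords_def card_PiE)

lemma card_verts_incidence_graph:
  fixes f :: "nat \<Rightarrow> 'a::{field,finite} poly"
  shows "card (verts (incidence_graph m f)) = 2 * CARD('a) ^ (m + 1)"
  using finite_coords[where 'a='a, of m] card_coords[where 'a='a, of m]
  by (simp add: incidence_graph_def card_Plus)

lemma graph_incidence_graph:
  fixes f :: "nat \<Rightarrow> 'a::{field,finite} poly"
  shows "graph (incidence_graph m f)"
proof -
  let ?G = "incidence_graph m f"
  have fin: "finite (pverts ?G)"
    using finite_coords[where 'a='a, of m] by (simp add: incidence_graph_def)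
  moreover have "parcs ?G \<subseteq> pverts ?G \<times> pverts ?G"
    by (auto simp: incidence_graph_def)
  ultimately have "finite (parcs ?G)"
    by (meson finite_SigmaI finite_subset)
  moreover have "symmetric ?G"
    by (auto simp: symmetric_def sym_def incidence_graph_def)
  ultimately show ?thesis
    using fin by unfold_locales (auto simp: incidence_graph_def arc_to_ends_def)
qed

text \<open>
  The list \<open>vs\<close> is an enumeration of the vertices. It fixes the order of rows and columns.
\<close>

definition adjacency_matrix :: "('v, 'e) pre_digraph \<Rightarrow> 'v list \<Rightarrow> complex mat" where
  "adjacency_matrix G vs =
    mat (length vs) (length vs) (\<lambda>(i, j). if vs ! i \<rightarrow>\<^bsub>G\<^esub> vs ! j then 1 else 0)"

definition eigenvalues_mset :: "complex mat \<Rightarrow> complex multiset" where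
  "eigenvalues_mset A = proots (char_poly A)"

definition lin_comb :: "nat \<Rightarrow> (nat \<Rightarrow> 'a::comm_semiring_1 poly) \<Rightarrow> (nat \<Rightarrow> 'a) \<Rightarrow> 'a \<Rightarrow> 'a" where
  "lin_comb m f w u = w 1 + (\<Sum>k=2..m+1. w k * poly (f k) u)"

definition num_zeros :: "nat \<Rightarrow> (nat \<Rightarrow> 'a::comm_semiring_1 poly) \<Rightarrow> (nat \<Rightarrow> 'a) \<Rightarrow> nat" where
  "num_zeros m f w = card {u. lin_comb m f w u = 0}"

text \<open>The vector space of all functions \<open>\<bbbF>\<^sub>q \<Rightarrow> \<bbbF>\<^sub>q\<close>.\<close>

global_interpretation fun_space: vector_space "\<lambda>(c::'a::field) (g::'a \<Rightarrow> 'a) u. c * g u"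
  by unfold_locales (auto simp: fun_eq_iff algebra_simps)

definition fun_rank :: "nat \<Rightarrow> (nat \<Rightarrow> 'a::field poly) \<Rightarrow> nat" where
  "fun_rank m f = fun_space.dim (coord_fun f ` {1..m+1})"

text \<open>
  Linear independence of the family \<open>1, f 2, \<dots>, f (m+1)\<close>, not of its set of members:
  a repeated function makes the family dependent.
\<close>

definition fun_independent :: "nat \<Rightarrow> (nat \<Rightarrow> 'a::field poly) \<Rightarrow> bool" where
  "fun_independent m f \<longleftrightarrow>
    (\<forall>w\<in>coords m. (\<forall>u. lin_comb m f w u = 0) \<longrightarrow> (\<forall>k\<in>{1..m+1}. w k = 0))"

end

theory Submission
  imports Defs
begin

text \<open>
  A line \<open>l\<close> is joined by a path of length two, through its point with first coordinate \<open>u\<close>,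
  exactly to the lines \<open>l + s \<vartheta>(u)\<close>. Hence the matrix \<open>B\<^sup>T B\<close> counting such paths
  (with \<open>B\<close> the point-line incidence matrix) is invariant under translations and is diagonalised by
  the characters \<open>l \<mapsto> \<chi>(w \<sqdot> l)\<close>, for a nontrivial additive character \<open>\<chi>\<close> of the field;
  since \<open>w \<sqdot> \<vartheta>(u) = F\<^sub>w(u)\<close>, the eigenvalue is
  \<open>\<Sum>\<^sub>u \<Sum>\<^sub>s \<chi>(s F\<^sub>w(u)) = q N\<close> with \<open>N\<close> the number of zeros of \<open>F\<^sub>w\<close>. The determinant of
  the block matrix with diagonal blocks \<open>x I\<close> and off-diagonal blocks \<open>-B\<close>, \<open>-B\<^sup>T\<close> is
  \<open>det (x\<^sup>2 I - B\<^sup>T B)\<close>, which turns this into the spectrum of the graph. The lines of a connected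
  component form a coset of the span of the vectors \<open>\<vartheta>(u)\<close>, whose dimension, the column rank of
  the matrix \<open>(f\<^sub>k(u))\<close>, is the rank of \<open>1, f\<^sub>2, \<dots>\<close>.
\<close>

subsection \<open>Additive characters\<close>

text \<open>Nontriviality is required at \<open>1\<close> itself, so that shifting the summation
  variable by \<open>1\<close> makes the sum over the field vanish.\<close>

locale additive_character =
  fixes \<chi> :: "'a::{field,finite} \<Rightarrow> complex"
  assumes chi_add: "\<chi> (x + y) = \<chi> x * \<chi> y"
    and chi_0: "\<chi> 0 = 1"
    and chi_1: "\<chi> 1 \<noteq> 1"

text \<open>If \<open>H\<close> is a maximal additive subgroup avoiding \<open>1\<close>, then every element is congruent modulo \<open>H\<close> to a
  multiple of \<open>1\<close>, unique modulo the characteristic \<open>p\<close>; the character sends it to that power of a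
  primitive \<open>p\<close>-th root of unity.\<close>

lemma ex_additive_character: "\<exists>\<chi> :: 'a::{field,finite} \<Rightarrow> complex. additive_character \<chi>"
proof -
  define p where "p = CHAR('a)"
  have "p > 0" unfolding p_def by (rule finite_imp_CHAR_pos) simp
  then have p: "prime p" unfolding p_def by (rule prime_CHAR_semidom)
  have p1: "p > 1" using p by (rule prime_gt_1_nat)
  have of_nat_p: "of_nat p = (0::'a)" by (simp add: p_def)
  \<comment> \<open>Negation is multiplication by the natural number \<open>p - 1\<close>, so
    closure under addition will give closure under negation.\<close>
  have neg1: "of_nat (p - 1) = (- 1 :: 'a)"
    using p1 of_nat_p by (simp add: of_nat_diff)
  have of_nat_inv: "\<exists>k. of_nat k * of_nat n = (1::'a)" if "of_nat n \<noteq> (0::'a)" for n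
  proof -
    have nd: "\<not> p dvd n" using that by (simp add: p_def of_nat_eq_0_iff_char_dvd)
    then have "coprime n p" using p by (metis coprime_commute prime_imp_coprime)
    moreover have "n \<noteq> 0" using nd by (metis dvd_0_right)
    ultimately obtain x y where "n * x = p * y + 1"
      using bezout_nat[of n p] by auto
    then have "of_nat (x * n) = (of_nat (p * y + 1) :: 'a)" by (simp add: mult.commute)
    then show ?thesis using of_nat_p by auto
  qed
  define sub :: "'a set \<Rightarrow> bool" where
    "sub H \<longleftrightarrow> 0 \<in> H \<and> (\<forall>x\<in>H. \<forall>y\<in>H. x + y \<in> H)" for H
  have of_nat_mem: "of_nat n * x \<in> H" if "sub H" "x \<in> H" for n x H
    using that by (induction n) (auto simp: sub_def algebra_simps)
  define S where "S = {H. sub H \<and> 1 \<notin> H}"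
  have "{0} \<in> S" by (simp add: S_def sub_def)
  moreover have "finite S" by simp
  ultimately obtain H where H: "H \<in> S" and max: "\<And>H'. H' \<in> S \<Longrightarrow> H \<subseteq> H' \<Longrightarrow> H = H'"
    using finite_has_maximal[of S] by blast
  have subH: "sub H" and H1: "1 \<notin> H" using H by (auto simp: S_def)
  have negH: "- x \<in> H" if "x \<in> H" for x
    using of_nat_mem[OF subH that, of "p - 1"] neg1 by simp
  have add_H: "x + y \<in> H" if "x \<in> H" "y \<in> H" for x y
    using subH that by (simp add: sub_def)
  have diffH: "x - y \<in> H" if "x \<in> H" "y \<in> H" for x y
    using add_H[OF that(1) negH[OF that(2)]] by simp
  \<comment> \<open>\<open>H\<close> meets the prime field only in 0: the inverse of a nonzero
    element, again in the prime field, would bring 1 into \<open>H\<close>.\<close>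
  have H_of_nat: "p dvd n" if "of_nat n \<in> H" for n
  proof (rule ccontr)
    assume "\<not> p dvd n"
    then have "of_nat n \<noteq> (0::'a)" by (simp add: p_def of_nat_eq_0_iff_char_dvd)
    then obtain k where "of_nat k * of_nat n = (1::'a)" using of_nat_inv by blast
    then show False using of_nat_mem[OF subH that, of k] H1 by simp
  qed
  have ex: "\<exists>k. x - of_nat k \<in> H" for x
  proof (cases "x \<in> H")
    case True
    then show ?thesis by (intro exI[of _ 0]) simp
  next
    case False
    \<comment> \<open>The subgroup generated by \<open>H\<close> and \<open>x\<close> is strictly
      larger, so by maximality it contains 1; that relation is then solved for \<open>x\<close>
      modulo \<open>H\<close>.\<close>
    let ?H' = "{h + of_nat n * x | h n. h \<in> H}"
    have "sub ?H'" unfolding sub_def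
    proof (intro conjI ballI)
      have "0 = 0 + of_nat 0 * x" by simp
      then show "0 \<in> ?H'" using subH unfolding sub_def by blast
      fix y z assume "y \<in> ?H'" "z \<in> ?H'"
      then obtain h n h' n' where "h \<in> H" "h' \<in> H" "y = h + of_nat n * x" "z = h' + of_nat n' * x"
        by blast
      then have "y + z = (h + h') + of_nat (n + n') * x" "h + h' \<in> H"
        using add_H by (auto simp: algebra_simps)
      then show "y + z \<in> ?H'" by blast
    qed
    moreover have "H \<subseteq> ?H'"
    proof
      fix h assume "h \<in> H"
      moreover have "h = h + of_nat 0 * x" by simp
      ultimately show "h \<in> ?H'" by blast
    qed
    moreover have "x \<in> ?H'"
    proof -
      have "x = 0 + of_nat 1 * x" by simp
      then show ?thesis using subH unfolding sub_def by blast
    qed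
    ultimately have "?H' \<notin> S" using max[of ?H'] False by blast
    with \<open>sub ?H'\<close> have "1 \<in> ?H'" by (simp add: S_def)
    then obtain h n where hn: "h \<in> H" "1 = h + of_nat n * x" by blast
    then have "of_nat n \<noteq> (0::'a)" using H1 by auto
    then obtain k where k: "of_nat k * of_nat n = (1::'a)" using of_nat_inv by blast
    have "of_nat k = of_nat k * h + (of_nat k * of_nat n) * x"
      by (metis hn(2) distrib_left mult.assoc mult.right_neutral)
    then have "x = of_nat k - of_nat k * h" by (simp add: k eq_diff_eq add.commute)
    then have "x - of_nat k = - (of_nat k * h)" by simp
    then show ?thesis using negH of_nat_mem[OF subH hn(1)] by metis
  qed
  define \<zeta> where "\<zeta> = cis (2 * pi / real p)"
  have zeta_p: "\<zeta> ^ p = 1" using p1 by (simp add: \<zeta>_def DeMoivre)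
  have zeta_nz: "\<zeta> ^ n \<noteq> 0" for n by (simp add: \<zeta>_def)
  have zeta_ne_1: "\<zeta> \<noteq> 1"
  proof
    assume "\<zeta> = 1"
    then have "cos (2 * pi / real p) = 1" by (auto simp: \<zeta>_def complex_eq_iff)
    then consider n :: nat where "2 * pi / real p = real n * 2 * pi"
      | n :: nat where "2 * pi / real p = - (real n * 2 * pi)"
      by (auto simp: cos_one_2pi)
    then show False
    proof cases
      case (1 n)
      then have "real (n * p) = 1" using p1 by (simp add: field_simps)
      then show False using p1 by (simp only: of_nat_eq_1_iff) simp
    next
      case (2 n)
      have "2 * pi / real p > 0" using p1 by simp
      moreover have "real n * 2 * pi \<ge> 0" by simp
      ultimately show False using 2 by linarith
    qed
  qed
  have well_defined: "\<zeta> ^ j = \<zeta> ^ k" if "x - of_nat j \<in> H" "x - of_nat k \<in> H" for x j k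
  proof -
    have "of_nat j - of_nat k \<in> H" using diffH[OF that(2,1)] by simp
    \<comment> \<open>Exponents are natural numbers, so \<open>- k\<close> is replaced by
      \<open>(p - 1) * k\<close>, congruent to it modulo \<open>p\<close>.\<close>
    then have "of_nat (j + (p - 1) * k) \<in> H" by (simp add: neg1 del: of_nat_diff One_nat_def)
    then have "p dvd j + (p - 1) * k" by (rule H_of_nat)
    then have "\<zeta> ^ (j + (p - 1) * k) = 1"
      using zeta_p by (auto simp: dvd_def power_mult)
    moreover have "k + (p - 1) * k = p * k" using p1 by (simp add: algebra_simps)
    then have "\<zeta> ^ (k + (p - 1) * k) = 1"
      using zeta_p by (simp add: power_mult)
    ultimately have "\<zeta> ^ j * \<zeta> ^ ((p - 1) * k) = \<zeta> ^ k * \<zeta> ^ ((p - 1) * k)"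
      by (simp only: power_add)
    then show ?thesis using mult_right_cancel[OF zeta_nz] by blast
  qed
  define \<kappa> where "\<kappa> x = (SOME k. x - of_nat k \<in> H)" for x
  have kappa: "x - of_nat (\<kappa> x) \<in> H" for x
    unfolding \<kappa>_def using ex[of x] by (rule someI_ex)
  have "additive_character (\<lambda>x. \<zeta> ^ \<kappa> x)"
  proof
    fix x y
    have "(x + y) - of_nat (\<kappa> x + \<kappa> y) = (x - of_nat (\<kappa> x)) + (y - of_nat (\<kappa> y))"
      by (simp add: algebra_simps)
    also have "\<dots> \<in> H" by (intro add_H kappa)
    finally show "\<zeta> ^ \<kappa> (x + y) = \<zeta> ^ \<kappa> x * \<zeta> ^ \<kappa> y"
      using well_defined[OF kappa] by (metis power_add)
  next
    have "0 - of_nat 0 \<in> H" using subH by (simp add: sub_def)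
    then show "\<zeta> ^ \<kappa> 0 = 1" using well_defined[OF kappa] by fastforce
  next
    have "1 - of_nat 1 \<in> H" using subH by (simp add: sub_def)
    then show "\<zeta> ^ \<kappa> 1 \<noteq> 1" using well_defined[OF kappa] zeta_ne_1 by fastforce
  qed
  then show ?thesis by blast
qed

section \<open>Orthogonality of additive characters\<close>

context additive_character
begin

lemma chi_sum: "\<chi> (\<Sum>i\<in>A. g i) = (\<Prod>i\<in>A. \<chi> (g i))"
  by (induction A rule: infinite_finite_induct) (auto simp: chi_0 chi_add)

text \<open>Translating the variable by 1 multiplies the full sum by \<open>\<chi> 1\<close>, which
  is not 1, so the sum is 0; for nonzero \<open>a\<close>, multiplication by \<open>a\<close>
  permutes the field.\<close>

lemma sum_chi_mult: "(\<Sum>x\<in>UNIV. \<chi> (x * a)) = (if a = 0 then of_nat CARD('a) else 0)"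
proof (cases "a = 0")
  case False
  let ?S = "\<Sum>x\<in>UNIV. \<chi> x"
  have "?S = (\<Sum>x\<in>UNIV. \<chi> (1 + x))"
    by (rule sum.reindex_bij_witness[of _ "\<lambda>x. 1 + x" "\<lambda>x. x - 1"]) auto
  also have "\<dots> = \<chi> 1 * ?S" by (simp add: chi_add sum_distrib_left)
  finally have "?S = 0" using chi_1 by simp
  moreover have "(\<Sum>x\<in>UNIV. \<chi> (x * a)) = ?S"
    using False by (intro sum.reindex_bij_witness[of _ "\<lambda>x. x / a" "\<lambda>x. x * a"]) auto
  ultimately show ?thesis using False by simp
qed (simp add: chi_0)

text \<open>The character turns the sum over coordinates into a product, so the sum over all vectors
  factors into one sum over the field per coordinate.\<close>

lemma sum_chi_linear_form:
  assumes "finite I"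
  shows "(\<Sum>w\<in>I \<rightarrow>\<^sub>E UNIV. \<chi> (\<Sum>k\<in>I. w k * a k)) =
    (if \<forall>k\<in>I. a k = 0 then of_nat (CARD('a) ^ card I) else 0)"
proof -
  have "(\<Sum>w\<in>I \<rightarrow>\<^sub>E UNIV. \<chi> (\<Sum>k\<in>I. w k * a k)) = (\<Prod>k\<in>I. \<Sum>x\<in>UNIV. \<chi> (x * a k))"
    by (simp add: chi_sum prod_sum_PiE[OF assms])
  also have "\<dots> = (\<Prod>k\<in>I. if a k = 0 then of_nat CARD('a) else 0)"
    by (simp add: sum_chi_mult)
  also have "\<dots> = (if \<forall>k\<in>I. a k = 0 then of_nat (CARD('a) ^ card I) else 0)"
    using assms by auto
  finally show ?thesis .
qed

end

subsection \<open>Determinants of matrices given by kernels\<close>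

lemma mult_if_zero:
  fixes a b :: "'a::mult_zero"
  shows "(if P then a else 0) * b = (if P then a * b else 0)"
    and "b * (if P then a else 0) = (if P then b * a else 0)"
  by simp_all

text \<open>Rows and columns are labelled by arbitrary objects, so that matrix identities become
  identities between sums over sets of labels.\<close>

definition kernel_mat :: "'v list \<Rightarrow> 'w list \<Rightarrow> ('v \<Rightarrow> 'w \<Rightarrow> 'a) \<Rightarrow> 'a mat" where
  "kernel_mat xs ys K = mat (length xs) (length ys) (\<lambda>(i, j). K (xs ! i) (ys ! j))"

lemma kernel_mat_carrier [simp]: "kernel_mat xs ys K \<in> carrier_mat (length xs) (length ys)"
  by (simp add: kernel_mat_def)

lemma kernel_mat_mult:
  assumes "distinct ys"
  shows "kernel_mat xs ys K * kernel_mat ys zs L =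
    kernel_mat xs zs (\<lambda>x z. \<Sum>y\<in>set ys. K x y * L y z)"
proof (rule eq_matI)
  fix i j
  assume "i < dim_row (kernel_mat xs zs (\<lambda>x z. \<Sum>y\<in>set ys. K x y * L y z))"
    and "j < dim_col (kernel_mat xs zs (\<lambda>x z. \<Sum>y\<in>set ys. K x y * L y z))"
  then show "(kernel_mat xs ys K * kernel_mat ys zs L) $$ (i, j) =
    kernel_mat xs zs (\<lambda>x z. \<Sum>y\<in>set ys. K x y * L y z) $$ (i, j)"
    using sum.reindex_bij_betw[OF bij_betw_nth[OF assms refl refl],
        of "\<lambda>y. K (xs ! i) y * L y (zs ! j)"]
    by (simp add: kernel_mat_def scalar_prod_def lessThan_atLeast0)
qed (auto simp: kernel_mat_def)

lemma kernel_mat_cong: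
  assumes "\<And>x y. x \<in> set xs \<Longrightarrow> y \<in> set ys \<Longrightarrow> K x y = L x y"
  shows "kernel_mat xs ys K = kernel_mat xs ys L"
  using assms by (auto simp: kernel_mat_def intro!: eq_matI)

lemma kernel_mat_delta:
  assumes "distinct xs"
  shows "kernel_mat xs xs (\<lambda>x y. if x = y then 1 else 0) = 1\<^sub>m (length xs)"
  using assms by (auto simp: kernel_mat_def nth_eq_iff_index_eq intro!: eq_matI)

lemma kernel_mat_append:
  "kernel_mat (xs @ xs') (ys @ ys') K =
    four_block_mat (kernel_mat xs ys K) (kernel_mat xs ys' K)
      (kernel_mat xs' ys K) (kernel_mat xs' ys' K)"
  by (rule eq_matI) (auto simp: kernel_mat_def nth_append)

lemma kernel_mat_map:
  "kernel_mat (map g xs) (map h ys) K = kernel_mat xs ys (\<lambda>x y. K (g x) (h y))"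
  by (rule eq_matI) (auto simp: kernel_mat_def)

text \<open>From \<open>K P = P D\<close> follows \<open>det K * det P = det P * det D\<close>; the
  right inverse \<open>Q\<close> makes \<open>det P\<close> nonzero, hence cancellable.\<close>

lemma det_kernel_mat_intertwine:
  fixes K :: "'v \<Rightarrow> 'v \<Rightarrow> 'a::idom"
  assumes "distinct xs" "distinct ys" "length xs = length ys"
    and inverse: "\<And>x x'. x \<in> set xs \<Longrightarrow> x' \<in> set xs \<Longrightarrow>
      (\<Sum>y\<in>set ys. P x y * Q y x') = (if x = x' then 1 else 0)"
    and intertwine: "\<And>x y. x \<in> set xs \<Longrightarrow> y \<in> set ys \<Longrightarrow>
      (\<Sum>x'\<in>set xs. K x x' * P x' y) = (\<Sum>y'\<in>set ys. P x y' * D y' y)"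
  shows "det (kernel_mat xs xs K) = det (kernel_mat ys ys D)"
proof -
  note carrier = kernel_mat_carrier[of xs xs, unfolded assms(3)]
    kernel_mat_carrier[of xs ys, unfolded assms(3)]
    kernel_mat_carrier[of ys xs, unfolded assms(3)] kernel_mat_carrier[of ys ys]
  have "kernel_mat xs ys P * kernel_mat ys xs Q =
      kernel_mat xs xs (\<lambda>x x'. \<Sum>y\<in>set ys. P x y * Q y x')"
    using assms(2) by (rule kernel_mat_mult)
  also have "\<dots> = kernel_mat xs xs (\<lambda>x x'. if x = x' then 1 else 0)"
    using inverse by (rule kernel_mat_cong)
  also have "\<dots> = 1\<^sub>m (length xs)"
    using assms(1) by (rule kernel_mat_delta)
  finally have "kernel_mat xs ys P * kernel_mat ys xs Q = 1\<^sub>m (length ys)"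
    by (simp only: assms(3))
  then have "det (kernel_mat xs ys P) * det (kernel_mat ys xs Q) = 1"
    by (simp only: det_mult[OF carrier(2,3), symmetric] det_one)
  then have nz: "det (kernel_mat xs ys P) \<noteq> 0" by auto
  have "kernel_mat xs xs K * kernel_mat xs ys P = kernel_mat xs ys P * kernel_mat ys ys D"
    unfolding kernel_mat_mult[OF assms(1)] kernel_mat_mult[OF assms(2)]
    using intertwine by (rule kernel_mat_cong)
  then have "det (kernel_mat xs xs K) * det (kernel_mat xs ys P) =
      det (kernel_mat xs ys P) * det (kernel_mat ys ys D)"
    by (simp only: det_mult[OF carrier(1,2), symmetric] det_mult[OF carrier(2,4), symmetric])
  then show ?thesis using nz by simp
qed

text \<open>The identity kernel, with rows in one order and columns in the other, is a permutation
  matrix intertwining the two.\<close>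

lemma det_kernel_mat_permute:
  fixes K :: "'v \<Rightarrow> 'v \<Rightarrow> 'a::idom"
  assumes "distinct xs" "distinct ys" "set xs = set ys"
  shows "det (kernel_mat xs xs K) = det (kernel_mat ys ys K)"
proof (rule det_kernel_mat_intertwine[where P = "\<lambda>x y. if x = y then 1 else 0"
      and Q = "\<lambda>x y. if x = y then 1 else 0"])
  show "length xs = length ys" using assms by (metis distinct_card)
qed (use assms in \<open>simp_all add: mult_if_zero\<close>)

lemma det_kernel_mat_diagonal:
  fixes d :: "'v \<Rightarrow> 'a::idom"
  assumes "distinct xs"
  shows "det (kernel_mat xs xs (\<lambda>x y. if x = y then d x else 0)) = (\<Prod>x\<in>set xs. d x)"
proof -
  let ?D = "kernel_mat xs xs (\<lambda>x y. if x = y then d x else 0)"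
  have "upper_triangular ?D"
    using assms by (auto simp: upper_triangular_def kernel_mat_def nth_eq_iff_index_eq)
  then have "det ?D = prod_list (diag_mat ?D)"
    by (rule det_upper_triangular) (rule kernel_mat_carrier)
  also have "diag_mat ?D = map d xs"
    by (rule nth_equalityI) (auto simp: diag_mat_def kernel_mat_def)
  also have "prod_list (map d xs) = (\<Prod>x\<in>set xs. d x)"
    using assms by (simp add: prod.distinct_set_conv_list)
  finally show ?thesis .
qed

text \<open>The diagonal blocks are scalar and commute with the others, so the determinant formula
  for 2 by 2 block matrices applies and halves the size.\<close>

lemma det_bipartite_kernel_mat:
  fixes K :: "'v + 'v \<Rightarrow> 'v + 'v \<Rightarrow> 'a::idom"
  assumes "distinct vs" "set vs = set cs <+> set cs" "distinct cs"
    and diag: "\<And>a b. K (Inl a) (Inl b) = (if a = b then x else 0)"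
      "\<And>a b. K (Inr a) (Inr b) = (if a = b then x else 0)"
  shows "det (kernel_mat vs vs K) =
    det (kernel_mat cs cs (\<lambda>a b. (if a = b then x\<^sup>2 else 0)
      - (\<Sum>c\<in>set cs. K (Inr a) (Inl c) * K (Inl c) (Inr b))))"
proof -
  \<comment> \<open>With the \<open>Inr\<close> vertices first, the product of the off-diagonal
    blocks is indexed by \<open>Inr\<close> labels and sums over \<open>Inl\<close> labels.\<close>
  let ?us = "map Inr cs @ map Inl cs"
  let ?X = "kernel_mat cs cs (\<lambda>a b. if a = b then x else 0)"
  let ?B = "kernel_mat cs cs (\<lambda>a b. K (Inr a) (Inl b))"
  let ?C = "kernel_mat cs cs (\<lambda>a b. K (Inl a) (Inr b))"
  have "det (kernel_mat vs vs K) = det (kernel_mat ?us ?us K)"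
    using assms by (intro det_kernel_mat_permute) (auto simp: distinct_map)
  also have "kernel_mat ?us ?us K = four_block_mat ?X ?B ?C ?X"
    by (simp add: kernel_mat_append kernel_mat_map diag)
  also have "det \<dots> = det (?X * ?X - ?B * ?C)"
  proof (rule det_four_block_mat)
    show "?C * ?X = ?X * ?C"
      using assms(3) by (auto simp: kernel_mat_mult mult_if_zero mult.commute intro!: kernel_mat_cong)
  qed (rule kernel_mat_carrier)+
  also have "?X * ?X = kernel_mat cs cs (\<lambda>a b. if a = b then x\<^sup>2 else 0)"
    using assms(3) by (auto simp: kernel_mat_mult mult_if_zero power2_eq_square intro!: kernel_mat_cong)
  also have "?B * ?C = kernel_mat cs cs (\<lambda>a b. \<Sum>c\<in>set cs. K (Inr a) (Inl c) * K (Inl c) (Inr b))"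
    using assms(3) by (rule kernel_mat_mult)
  also have "kernel_mat cs cs (\<lambda>a b. if a = b then x\<^sup>2 else 0) - \<dots> =
      kernel_mat cs cs (\<lambda>a b. (if a = b then x\<^sup>2 else 0)
        - (\<Sum>c\<in>set cs. K (Inr a) (Inl c) * K (Inl c) (Inr b)))"
    by (rule eq_matI) (simp_all add: kernel_mat_def)
  finally show ?thesis .
qed

subsection \<open>Rank of the coordinate functions\<close>

lemma lin_comb_altdef: "lin_comb m f w u = (\<Sum>k=1..m+1. w k * coord_fun f k u)"
proof -
  have "(\<Sum>k=1..m+1. w k * coord_fun f k u) = w 1 + (\<Sum>k=2..m+1. w k * coord_fun f k u)"
    by (simp add: sum.atLeast_Suc_atMost coord_fun_def del: One_nat_def)
  also have "(\<Sum>k=2..m+1. w k * coord_fun f k u) = (\<Sum>k=2..m+1. w k * poly (f k) u)"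
    by (intro sum.cong) (auto simp: coord_fun_def)
  finally show ?thesis by (simp add: lin_comb_def)
qed

lemma coords_eqI:
  assumes "v \<in> coords m" "w \<in> coords m" "\<And>k. k \<in> {1..m+1} \<Longrightarrow> v k = w k"
  shows "v = w"
  using assms unfolding coords_def by (rule PiE_ext)

lemma lin_comb_add:
  "lin_comb m f (\<lambda>k\<in>{1..m+1}. v k + w k) u = lin_comb m f v u + lin_comb m f w u"
  unfolding lin_comb_altdef by (simp add: algebra_simps sum.distrib)

lemma lin_comb_diff:
  fixes f :: "nat \<Rightarrow> 'a::comm_ring_1 poly"
  shows "lin_comb m f (\<lambda>k\<in>{1..m+1}. v k - w k) u = lin_comb m f v u - lin_comb m f w u"
  unfolding lin_comb_altdef by (simp add: algebra_simps sum_subtractf)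

text \<open>Common counting form of rank-nullity and of the partition into cosets of equal
  size.\<close>

lemma card_eq_fibre_times_image:
  assumes "finite A" "\<And>x. x \<in> A \<Longrightarrow> card {y \<in> A. h y = h x} = k"
  shows "card A = k * card (h ` A)"
proof -
  have "card A = (\<Sum>z\<in>h ` A. card {y \<in> A. h y = z})"
    using sum.image_gen[OF assms(1), of "\<lambda>_. 1::nat" h] by simp
  also have "\<dots> = (\<Sum>z\<in>h ` A. k)"
    using assms(2) by (intro sum.cong) auto
  finally show ?thesis by (simp add: mult.commute)
qed

text \<open>Linear relations among the coordinate functions: the kernel of
  \<open>lin_comb m f\<close>.\<close>

definition null_combs :: "nat \<Rightarrow> (nat \<Rightarrow> 'a::comm_semiring_1 poly) \<Rightarrow> (nat \<Rightarrow> 'a) set" where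
  "null_combs m f = {w \<in> coords m. \<forall>u. lin_comb m f w u = 0}"

text \<open>Linear relations among the vectors \<open>vartheta m f u\<close>: the kernel of the
  transpose of \<open>lin_comb m f\<close>.\<close>

definition null_weights :: "nat \<Rightarrow> (nat \<Rightarrow> 'a::{comm_semiring_1,finite} poly) \<Rightarrow> ('a \<Rightarrow> 'a) set" where
  "null_weights m f = {c. \<forall>k\<in>{1..m+1}. (\<Sum>u\<in>UNIV. c u * coord_fun f k u) = 0}"

text \<open>Each element of the span has unique coefficients over a basis, and these range freely
  over the field.\<close>

lemma card_span_eq_power_dim:
  fixes S :: "('a::{field,finite} \<Rightarrow> 'a) set"
  shows "card (fun_space.span S) = CARD('a) ^ fun_space.dim S"
proof -
  obtain B where B: "B \<subseteq> S" "fun_space.independent B" "S \<subseteq> fun_space.span B"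
    "card B = fun_space.dim S"
    by (rule fun_space.basis_exists[of S])
  have fin: "finite B" by simp
  have span: "fun_space.span S = fun_space.span B"
    unfolding fun_space.span_eq using B(1,3) fun_space.span_superset[of S] by blast
  let ?comb = "\<lambda>c. \<Sum>b\<in>B. (\<lambda>u. c b * b u)"
  have "fun_space.span B = ?comb ` (B \<rightarrow>\<^sub>E UNIV)"
  proof -
    have "fun_space.span B = range ?comb" by (rule fun_space.span_finite[OF fin])
    also have "\<dots> = ?comb ` (B \<rightarrow>\<^sub>E UNIV)"
    proof
      show "range ?comb \<subseteq> ?comb ` (B \<rightarrow>\<^sub>E UNIV)"
      proof
        fix g assume "g \<in> range ?comb"
        then obtain c where "g = ?comb c" by blast
        \<comment> \<open>Restriction to \<open>B\<close> makes the coefficient function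
          extensional, as the injectivity below requires.\<close>
        also have "\<dots> = ?comb (restrict c B)" by (intro sum.cong) auto
        moreover have "restrict c B \<in> B \<rightarrow>\<^sub>E UNIV" by simp
        ultimately show "g \<in> ?comb ` (B \<rightarrow>\<^sub>E UNIV)" by blast
      qed
    qed blast
    finally show ?thesis .
  qed
  moreover have "inj_on ?comb (B \<rightarrow>\<^sub>E UNIV)"
  proof (rule inj_onI)
    fix c d assume cd: "c \<in> B \<rightarrow>\<^sub>E UNIV" "d \<in> B \<rightarrow>\<^sub>E UNIV" and eq: "?comb c = ?comb d"
    have "?comb (\<lambda>b. c b - d b) = ?comb c - ?comb d"
      unfolding sum_subtractf[symmetric] by (intro sum.cong) (auto simp: algebra_simps)
    then have zero: "?comb (\<lambda>b. c b - d b) = 0" using eq by simp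
    have "c b - d b = 0" if "b \<in> B" for b
      using fun_space.independentD[OF B(2) fin subset_refl zero that] .
    then show "c = d" using cd by (intro PiE_ext[OF cd]) simp
  qed
  ultimately have "card (fun_space.span S) = card (B \<rightarrow>\<^sub>E (UNIV :: 'a set))"
    by (simp add: span card_image)
  then show ?thesis using B(4) by (simp add: card_PiE)
qed

text \<open>The combinations form a subspace, and unit vectors yield the coordinate functions. Hence
  the image of \<open>lin_comb m f\<close> has dimension \<open>fun_rank m f\<close>.\<close>

lemma span_coord_fun:
  fixes f :: "nat \<Rightarrow> 'a::{field,finite} poly"
  shows "fun_space.span (coord_fun f ` {1..m+1}) = lin_comb m f ` coords m"
proof -
  have comb: "lin_comb m f w = (\<Sum>k=1..m+1. (\<lambda>u. w k * coord_fun f k u))" for w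
  proof
    fix u
    have "(\<Sum>k\<in>A. (\<lambda>u. w k * coord_fun f k u)) u = (\<Sum>k\<in>A. w k * coord_fun f k u)"
      if "finite A" for A
      using that by induction auto
    then show "lin_comb m f w u = (\<Sum>k=1..m+1. (\<lambda>u. w k * coord_fun f k u)) u"
      by (simp add: lin_comb_altdef)
  qed
  show ?thesis
  proof
    show "lin_comb m f ` coords m \<subseteq> fun_space.span (coord_fun f ` {1..m+1})"
      unfolding comb
      by (intro image_subsetI fun_space.span_sum fun_space.span_scale fun_space.span_base imageI)
    have "coord_fun f ` {1..m+1} \<subseteq> lin_comb m f ` coords m"
    proof
      fix g assume "g \<in> coord_fun f ` {1..m+1}"
      then obtain k where k: "k \<in> {1..m+1}" "g = coord_fun f k" by blast
      let ?e = "\<lambda>j\<in>{1..m+1}. if j = k then 1 else 0"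
      have "lin_comb m f ?e u = g u" for u
      proof -
        have "lin_comb m f ?e u = (\<Sum>j=1..m+1. if j = k then coord_fun f k u else 0)"
          unfolding lin_comb_altdef by (intro sum.cong) auto
        then show ?thesis using k by simp
      qed
      then have "g = lin_comb m f ?e" by auto
      moreover have "?e \<in> coords m" by (simp add: coords_def)
      ultimately show "g \<in> lin_comb m f ` coords m" by blast
    qed
    moreover have "fun_space.subspace (lin_comb m f ` coords m)"
      unfolding fun_space.subspace_def
    proof (intro conjI ballI allI)
      have "0 = lin_comb m f (\<lambda>k\<in>{1..m+1}. 0)"
        by (auto simp: lin_comb_altdef)
      moreover have "(\<lambda>k\<in>{1..m+1}. 0) \<in> coords m" by (simp add: coords_def)
      ultimately show "0 \<in> lin_comb m f ` coords m" by blast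
    next
      fix g h assume "g \<in> lin_comb m f ` coords m" "h \<in> lin_comb m f ` coords m"
      then obtain v w where "g = lin_comb m f v" "h = lin_comb m f w" by blast
      then have "g + h = lin_comb m f (\<lambda>k\<in>{1..m+1}. v k + w k)"
        by (simp add: fun_eq_iff lin_comb_add del: restrict_apply One_nat_def)
      moreover have "(\<lambda>k\<in>{1..m+1}. v k + w k) \<in> coords m" by (simp add: coords_def)
      ultimately show "g + h \<in> lin_comb m f ` coords m" by blast
    next
      fix c g assume "g \<in> lin_comb m f ` coords m"
      then obtain w where "g = lin_comb m f w" by blast
      then have "(\<lambda>u. c * g u) = lin_comb m f (\<lambda>k\<in>{1..m+1}. c * w k)"
        by (simp add: fun_eq_iff lin_comb_altdef sum_distrib_left mult.assoc del: One_nat_def)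
      moreover have "(\<lambda>k\<in>{1..m+1}. c * w k) \<in> coords m" by (simp add: coords_def)
      ultimately show "(\<lambda>u. c * g u) \<in> lin_comb m f ` coords m" by blast
    qed
    ultimately show "fun_space.span (coord_fun f ` {1..m+1}) \<subseteq> lin_comb m f ` coords m"
      by (rule fun_space.span_minimal)
  qed
qed

text \<open>Rank-nullity by counting: every fibre of \<open>lin_comb m f\<close> is a translate of
  its kernel, and its image is the span of the coordinate functions.\<close>

lemma card_null_combs:
  fixes f :: "nat \<Rightarrow> 'a::{field,finite} poly"
  shows "card (null_combs m f) * CARD('a) ^ fun_rank m f = CARD('a) ^ (m + 1)"
proof -
  have "card (coords m :: (nat \<Rightarrow> 'a) set) = card (null_combs m f) * card (lin_comb m f ` coords m)"
  proof (rule card_eq_fibre_times_image[OF finite_coords])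
    fix w :: "nat \<Rightarrow> 'a" assume w: "w \<in> coords m"
    show "card {v \<in> coords m. lin_comb m f v = lin_comb m f w} = card (null_combs m f)"
    proof (rule bij_betw_same_card[of "\<lambda>v. \<lambda>k\<in>{1..m+1}. v k - w k"],
        rule bij_betwI[where g = "\<lambda>v. \<lambda>k\<in>{1..m+1}. v k + w k"])
      show "(\<lambda>v. \<lambda>k\<in>{1..m+1}. v k - w k) \<in>
          {v \<in> coords m. lin_comb m f v = lin_comb m f w} \<rightarrow> null_combs m f"
        by (auto simp: null_combs_def lin_comb_diff coords_def simp del: restrict_apply One_nat_def)
      show "(\<lambda>v. \<lambda>k\<in>{1..m+1}. v k + w k) \<in>
          null_combs m f \<rightarrow> {v \<in> coords m. lin_comb m f v = lin_comb m f w}"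
        by (auto simp: null_combs_def lin_comb_add coords_def fun_eq_iff simp del: restrict_apply One_nat_def)
    qed (auto simp: null_combs_def coords_def PiE_def extensional_def fun_eq_iff)
  qed
  then show ?thesis
    by (simp add: card_coords fun_rank_def card_span_eq_power_dim flip: span_coord_fun)
qed

text \<open>The rank of \<open>m + 1\<close> functions is at most \<open>m + 1\<close>, so the
  subtraction in the exponent does not truncate.\<close>

lemma card_null_combs_rank:
  fixes f :: "nat \<Rightarrow> 'a::{field,finite} poly"
  shows "card (null_combs m f) = CARD('a) ^ (m + 1 - fun_rank m f)"
proof -
  have "card (coord_fun f ` {1..m+1}) \<le> m + 1"
    using card_image_le[of "{1..m+1}" "coord_fun f"] by simp
  moreover have "fun_rank m f \<le> card (coord_fun f ` {1..m+1})"
    unfolding fun_rank_def by (rule fun_space.dim_le_card') simp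
  ultimately have "fun_rank m f \<le> m + 1" by linarith
  then have "CARD('a) ^ (m + 1) = CARD('a) ^ (m + 1 - fun_rank m f) * CARD('a) ^ fun_rank m f"
    by (subst power_add[symmetric]) simp
  then have "card (null_combs m f) * CARD('a) ^ fun_rank m f =
      CARD('a) ^ (m + 1 - fun_rank m f) * CARD('a) ^ fun_rank m f"
    using card_null_combs[of m f] by argo
  then show ?thesis by simp
qed

lemma card_null_combs_eq_1_iff:
  fixes f :: "nat \<Rightarrow> 'a::{field,finite} poly"
  shows "card (null_combs m f) = 1 \<longleftrightarrow> fun_independent m f"
proof -
  let ?z = "\<lambda>k\<in>{1..m+1}. 0 :: 'a"
  have z: "?z \<in> null_combs m f"
    by (simp add: null_combs_def coords_def lin_comb_altdef)
  have zero_iff: "w = ?z \<longleftrightarrow> (\<forall>k\<in>{1..m+1}. w k = 0)" if "w \<in> coords m" for w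
    using that by (auto simp: coords_def PiE_def extensional_def fun_eq_iff)
  have "card (null_combs m f) = 1 \<longleftrightarrow> null_combs m f = {?z}"
    using z by (auto simp: card_1_singleton_iff)
  also have "\<dots> \<longleftrightarrow> (\<forall>w\<in>null_combs m f. w = ?z)" using z by blast
  also have "\<dots> \<longleftrightarrow> fun_independent m f"
    unfolding fun_independent_def null_combs_def using zero_iff by blast
  finally show ?thesis .
qed

text \<open>Row rank equals column rank, by summing an additive character over all values of the bilinear
  pairing of coefficient vectors and weights, in both orders.\<close>

lemma card_null_weights:
  fixes f :: "nat \<Rightarrow> 'a::{field,finite} poly"
  shows "CARD('a) ^ (m + 1) * card (null_weights m f) = CARD('a) ^ CARD('a) * card (null_combs m f)"
proof -
  obtain \<chi> :: "'a \<Rightarrow> complex" where "additive_character \<chi>"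
    using ex_additive_character by blast
  then interpret additive_character \<chi> .
  let ?I = "{1..m+1}"
  \<comment> \<open>With \<open>w\<close> innermost, the inner sum detects whether the vectors
    \<open>vartheta m f u\<close>, weighted by \<open>c\<close>, add up to 0.\<close>
  have "(\<Sum>c\<in>UNIV. \<Sum>w\<in>coords m. \<chi> (\<Sum>k\<in>?I. w k * (\<Sum>u\<in>UNIV. c u * coord_fun f k u))) =
      (\<Sum>c\<in>UNIV. if c \<in> null_weights m f then of_nat (CARD('a) ^ (m + 1)) else 0)"
    unfolding coords_def by (subst sum_chi_linear_form) (simp_all add: null_weights_def cong: if_cong)
  also have "\<dots> = of_nat (CARD('a) ^ (m + 1) * card (null_weights m f))"
    by (simp add: sum.If_cases)
  finally have 1: "(\<Sum>c\<in>UNIV. \<Sum>w\<in>coords m. \<chi> (\<Sum>k\<in>?I. w k * (\<Sum>u\<in>UNIV. c u * coord_fun f k u))) =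
      of_nat (CARD('a) ^ (m + 1) * card (null_weights m f))" .
  \<comment> \<open>With \<open>c\<close> innermost, the exponent is linear in \<open>c\<close> with
    coefficients \<open>lin_comb m f w u\<close>, so the inner sum detects whether \<open>w\<close>
    is a relation.\<close>
  have "(\<Sum>c\<in>UNIV. \<Sum>w\<in>coords m. \<chi> (\<Sum>k\<in>?I. w k * (\<Sum>u\<in>UNIV. c u * coord_fun f k u))) =
      (\<Sum>w\<in>coords m. \<Sum>c\<in>UNIV \<rightarrow>\<^sub>E UNIV. \<chi> (\<Sum>u\<in>UNIV. c u * lin_comb m f w u))"
  proof (subst sum.swap, intro sum.cong)
    fix w :: "nat \<Rightarrow> 'a" and c :: "'a \<Rightarrow> 'a"
    have "(\<Sum>k\<in>?I. w k * (\<Sum>u\<in>UNIV. c u * coord_fun f k u)) =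
        (\<Sum>k\<in>?I. \<Sum>u\<in>UNIV. c u * (w k * coord_fun f k u))"
      by (simp only: sum_distrib_left mult.left_commute)
    also have "\<dots> = (\<Sum>u\<in>UNIV. c u * lin_comb m f w u)"
      by (subst sum.swap) (simp only: sum_distrib_left lin_comb_altdef)
    finally show "\<chi> (\<Sum>k\<in>?I. w k * (\<Sum>u\<in>UNIV. c u * coord_fun f k u)) =
        \<chi> (\<Sum>u\<in>UNIV. c u * lin_comb m f w u)" by (rule arg_cong)
  qed simp_all
  also have "\<dots> = (\<Sum>w\<in>coords m. if w \<in> null_combs m f then of_nat (CARD('a) ^ CARD('a)) else 0)"
    by (subst sum_chi_linear_form) (auto simp: null_combs_def intro!: sum.cong)
  also have "\<dots> = (\<Sum>w\<in>null_combs m f. of_nat (CARD('a) ^ CARD('a)))"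
    by (rule sum.mono_neutral_cong_right) (auto simp: finite_coords null_combs_def)
  also have "\<dots> = of_nat (CARD('a) ^ CARD('a) * card (null_combs m f))"
    by simp
  finally show ?thesis using 1 by (metis of_nat_eq_iff)
qed

subsection \<open>Connected components\<close>

text \<open>The incidence equations determine a line through \<open>p\<close> from its first
  coordinate; \<open>point_on\<close> is the analogue for points.\<close>

definition line_through :: "nat \<Rightarrow> (nat \<Rightarrow> 'a::comm_ring_1 poly) \<Rightarrow> (nat \<Rightarrow> 'a) \<Rightarrow> 'a \<Rightarrow> nat \<Rightarrow> 'a" where
  "line_through m f p t = (\<lambda>k\<in>{1..m+1}. if k = 1 then t else poly (f k) (p 1) * t - p k)"

definition point_on :: "nat \<Rightarrow> (nat \<Rightarrow> 'a::comm_ring_1 poly) \<Rightarrow> (nat \<Rightarrow> 'a) \<Rightarrow> 'a \<Rightarrow> nat \<Rightarrow> 'a" where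
  "point_on m f l u = (\<lambda>k\<in>{1..m+1}. if k = 1 then u else poly (f k) u * l 1 - l k)"

lemma line_through_in_coords [simp]: "line_through m f p t \<in> coords m"
  by (simp add: line_through_def coords_def)

lemma point_on_in_coords [simp]: "point_on m f l u \<in> coords m"
  by (simp add: point_on_def coords_def)

lemma line_through_1 [simp]: "line_through m f p t 1 = t"
  by (simp add: line_through_def)

lemma point_on_1 [simp]: "point_on m f l u 1 = u"
  by (simp add: point_on_def)

lemma incident_iff_line_through:
  assumes "l \<in> coords m"
  shows "incident m f p l \<longleftrightarrow> l = line_through m f p (l 1)"
proof
  assume "incident m f p l"
  then show "l = line_through m f p (l 1)"
    using assms by (intro coords_eqI[of l m]) (auto simp: incident_def line_through_def coords_def eq_diff_eq)
next
  assume l: "l = line_through m f p (l 1)"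
  show "incident m f p l"
    unfolding incident_def by (subst (1) l) (auto simp: line_through_def)
qed

lemma incident_iff_point_on:
  assumes "p \<in> coords m"
  shows "incident m f p l \<longleftrightarrow> p = point_on m f l (p 1)"
proof
  assume "incident m f p l"
  then show "p = point_on m f l (p 1)"
    using assms by (intro coords_eqI[of p m])
      (auto simp: incident_def point_on_def coords_def eq_diff_eq add.commute)
next
  assume p: "p = point_on m f l (p 1)"
  show "incident m f p l"
    unfolding incident_def by (subst (1) p) (auto simp: point_on_def)
qed

text \<open>The lines on \<open>p\<close> are parametrised bijectively by their first
  coordinate.\<close>

lemma sum_incident_lines:
  fixes f :: "nat \<Rightarrow> 'a::{comm_ring_1,finite} poly"
  shows "(\<Sum>l\<in>coords m. if incident m f p l then g l else 0) = (\<Sum>t\<in>UNIV. g (line_through m f p t))"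
proof -
  have "(\<Sum>l\<in>coords m. if incident m f p l then g l else 0) =
      (\<Sum>l\<in>{l \<in> coords m. incident m f p l}. g l)"
    by (rule sum.inter_filter[symmetric]) (rule finite_coords)
  also have "\<dots> = (\<Sum>t\<in>UNIV. g (line_through m f p t))"
    by (rule sum.reindex_bij_witness[of _ "line_through m f p" "\<lambda>l. l 1"])
      (auto simp: incident_iff_line_through simp del: One_nat_def)
  finally show ?thesis .
qed

lemma sum_incident_points:
  fixes f :: "nat \<Rightarrow> 'a::{comm_ring_1,finite} poly"
  shows "(\<Sum>p\<in>coords m. if incident m f p l then g p else 0) = (\<Sum>u\<in>UNIV. g (point_on m f l u))"
proof -
  have "(\<Sum>p\<in>coords m. if incident m f p l then g p else 0) =
      (\<Sum>p\<in>{p \<in> coords m. incident m f p l}. g p)"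
    by (rule sum.inter_filter[symmetric]) (rule finite_coords)
  also have "\<dots> = (\<Sum>u\<in>UNIV. g (point_on m f l u))"
    by (rule sum.reindex_bij_witness[of _ "point_on m f l" "\<lambda>p. p 1"])
      (auto simp: incident_iff_point_on simp del: One_nat_def)
  finally show ?thesis .
qed

text \<open>Eliminating the common point from two incidence equations leaves a displacement along
  \<open>vartheta m f u\<close>, scaled by the change of first coordinate.\<close>

lemma line_through_point_on:
  assumes "k \<in> {1..m+1}"
  shows "line_through m f (point_on m f l u) t k = l k + (t - l 1) * coord_fun f k u"
  using assms by (auto simp: line_through_def point_on_def coord_fun_def algebra_simps)

text \<open>As \<open>c\<close> varies, these run through the coset of \<open>l\<close> modulo the
  span of the vectors \<open>vartheta m f u\<close>; the weights record a walk step by step.\<close>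

definition translate ::
    "nat \<Rightarrow> (nat \<Rightarrow> 'a::{comm_ring_1,finite} poly) \<Rightarrow> (nat \<Rightarrow> 'a) \<Rightarrow> ('a \<Rightarrow> 'a) \<Rightarrow> nat \<Rightarrow> 'a" where
  "translate m f l c = (\<lambda>k\<in>{1..m+1}. l k + (\<Sum>u\<in>UNIV. c u * coord_fun f k u))"

lemma translate_in_coords [simp]: "translate m f l c \<in> coords m"
  by (simp add: translate_def coords_def)

lemma translate_0: "l \<in> coords m \<Longrightarrow> translate m f l (\<lambda>_. 0) = l"
  by (rule coords_eqI[of _ m]) (auto simp: translate_def coords_def)

text \<open>A walk of length two through the point with first coordinate \<open>u\<close> adds a
  multiple of \<open>vartheta m f u\<close>, so only the weight at \<open>u\<close> changes.\<close>

lemma line_through_point_on_translate: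
  "line_through m f (point_on m f (translate m f l c) u) t =
    translate m f l (c(u := c u + t - translate m f l c 1))"
proof (rule coords_eqI[of _ m])
  fix k assume k: "k \<in> {1..m+1}"
  define s where "s = t - translate m f l c 1"
  have "(\<Sum>v\<in>UNIV. (c(u := c u + s)) v * coord_fun f k v) =
      (\<Sum>v\<in>UNIV. c v * coord_fun f k v + (if v = u then s * coord_fun f k u else 0))"
    by (intro sum.cong) (auto simp: algebra_simps)
  also have "\<dots> = (\<Sum>v\<in>UNIV. c v * coord_fun f k v) + s * coord_fun f k u"
    by (simp add: sum.distrib)
  finally have "translate m f l (c(u := c u + s)) k = translate m f l c k + s * coord_fun f k u"
    using k by (simp add: translate_def)
  then show "line_through m f (point_on m f (translate m f l c) u) t k =
      translate m f l (c(u := c u + t - translate m f l c 1)) k"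
    using k by (simp only: line_through_point_on s_def add_diff_eq)
qed simp_all

lemma adj_incidence_graph:
  "Inl p \<rightarrow>\<^bsub>incidence_graph m f\<^esub> Inr l \<longleftrightarrow> p \<in> coords m \<and> l \<in> coords m \<and> incident m f p l"
  "Inr l \<rightarrow>\<^bsub>incidence_graph m f\<^esub> Inl p \<longleftrightarrow> p \<in> coords m \<and> l \<in> coords m \<and> incident m f p l"
  "\<not> Inl p \<rightarrow>\<^bsub>incidence_graph m f\<^esub> Inl p'"
  "\<not> Inr l \<rightarrow>\<^bsub>incidence_graph m f\<^esub> Inr l'"
  by (auto simp: incidence_graph_def)

section \<open>Components as cosets of lines\<close>

context
  fixes f :: "nat \<Rightarrow> 'a::{field,finite} poly" and m :: nat
begin

interpretation G: graph "with_proj (incidence_graph m f)"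
  by (rule graph_incidence_graph)

text \<open>The weights are introduced one field element at a time, each by a walk of length
  two.\<close>

lemma reachable_line_translate:
  assumes l: "l \<in> coords m"
  shows "Inr l \<rightarrow>\<^sup>*\<^bsub>incidence_graph m f\<^esub> Inr (translate m f l c)"
proof -
  have "Inr l \<rightarrow>\<^sup>*\<^bsub>incidence_graph m f\<^esub> Inr (translate m f l (\<lambda>u. if u \<in> A then c u else 0))"
    if "finite A" for A
    using that
  proof induction
    case empty
    have "Inr l \<in> verts (incidence_graph m f)" using l by (auto simp: incidence_graph_def)
    then show ?case using l by (simp add: translate_0)
  next
    case (insert u A)
    let ?d = "\<lambda>v. if v \<in> A then c v else 0"
    let ?l = "translate m f l ?d"
    let ?p = "point_on m f ?l u"
    \<comment> \<open>Raising the first coordinate by \<open>c u\<close> adds exactly this weight at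
      \<open>u\<close>, where it was 0 because \<open>u\<close> is not in \<open>A\<close>.\<close>
    let ?l' = "line_through m f ?p (c u + ?l 1)"
    note insert.IH
    also have "Inr ?l \<rightarrow>\<^bsub>incidence_graph m f\<^esub> Inl ?p"
      by (simp only: adj_incidence_graph incident_iff_point_on point_on_in_coords
          translate_in_coords point_on_1 simp_thms)
    also have "Inl ?p \<rightarrow>\<^bsub>incidence_graph m f\<^esub> Inr ?l'"
      by (simp only: adj_incidence_graph incident_iff_line_through point_on_in_coords
          line_through_in_coords line_through_1 simp_thms)
    finally have reach: "Inr l \<rightarrow>\<^sup>*\<^bsub>incidence_graph m f\<^esub> Inr ?l'" .
    have "?d(u := ?d u + (c u + ?l 1) - ?l 1) = (\<lambda>v. if v \<in> insert u A then c v else 0)"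
      using insert.hyps(2) by auto
    then have "?l' = translate m f l (\<lambda>v. if v \<in> insert u A then c v else 0)"
      by (simp only: line_through_point_on_translate)
    with reach show ?case by (simp only:)
  qed
  from this[of UNIV] show ?thesis by simp
qed

text \<open>Invariant of walks from \<open>l\<close>: a point on the way is described by a translate
  of \<open>l\<close> incident with it, so the induction passes through both vertex classes.\<close>

lemma reachable_from_line_cases:
  assumes "Inr l \<rightarrow>\<^sup>*\<^bsub>incidence_graph m f\<^esub> v"
  shows "(\<exists>c. v = Inr (translate m f l c)) \<or>
    (\<exists>p c. v = Inl p \<and> p \<in> coords m \<and> incident m f p (translate m f l c))"
  using assms
proof (induction rule: G.reachable_induct)
  case base
  then have "l \<in> coords m" by (auto simp: incidence_graph_def)
  then show ?case by (metis translate_0)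
next
  case (step v w)
  from step.IH show ?case
  proof (elim disjE exE conjE)
    fix c assume v: "v = Inr (translate m f l c)"
    with step.hyps(2) show ?thesis
      by (cases w) (auto simp only: adj_incidence_graph)
  next
    fix p c assume v: "v = Inl p" and p: "p \<in> coords m" "incident m f p (translate m f l c)"
    with step.hyps(2) obtain l' where w: "w = Inr l'" "l' \<in> coords m" "incident m f p l'"
      by (cases w) (auto simp only: adj_incidence_graph)
    have "p = point_on m f (translate m f l c) (p 1)"
      using p incident_iff_point_on by blast
    moreover have "l' = line_through m f p (l' 1)"
      using w incident_iff_line_through by blast
    ultimately have "l' = line_through m f (point_on m f (translate m f l c) (p 1)) (l' 1)"
      by simp
    then show ?thesis using w(1) line_through_point_on_translate by metis
  qed
qed

text \<open>Arcs are symmetric, so the component of a line is everything reachable from it, and the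
  two preceding lemmas say which lines these are.\<close>

lemma scc_of_line_eq_iff:
  assumes "l \<in> coords m" "l' \<in> coords m"
  shows "G.scc_of (Inr l') = G.scc_of (Inr l) \<longleftrightarrow> l' \<in> range (translate m f l)"
proof
  assume "G.scc_of (Inr l') = G.scc_of (Inr l)"
  moreover have "Inr l' \<in> G.scc_of (Inr l')"
    using assms by (intro G.in_scc_of_self) (auto simp: incidence_graph_def)
  ultimately have "Inr l \<rightarrow>\<^sup>*\<^bsub>incidence_graph m f\<^esub> Inr l'"
    by (auto simp: G.scc_of_def)
  then show "l' \<in> range (translate m f l)"
    using reachable_from_line_cases by blast
next
  assume "l' \<in> range (translate m f l)"
  then obtain c where "l' = translate m f l c" by blast
  then have "Inr l \<rightarrow>\<^sup>*\<^bsub>incidence_graph m f\<^esub> Inr l'"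
    by (simp only: reachable_line_translate[OF assms(1)])
  then show "G.scc_of (Inr l') = G.scc_of (Inr l)"
    by (rule G.scc_of_eq[OF G.scc_ofI_reachable'])
qed

text \<open>Every point has a neighbour, for instance the line through it with first coordinate 0,
  so every component contains a line.\<close>

lemma sccs_verts_eq: "G.sccs_verts = (\<lambda>l. G.scc_of (Inr l)) ` coords m"
proof -
  have "G.scc_of v \<in> (\<lambda>l. G.scc_of (Inr l)) ` coords m" if v: "v \<in> verts (incidence_graph m f)" for v
  proof (cases v)
    case (Inl p)
    with v have "p \<in> coords m" by (auto simp: incidence_graph_def)
    then have "Inl p \<rightarrow>\<^bsub>incidence_graph m f\<^esub> Inr (line_through m f p 0)"
      by (simp only: adj_incidence_graph incident_iff_line_through line_through_in_coords
          line_through_1 simp_thms)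
    then have "G.scc_of v = G.scc_of (Inr (line_through m f p 0))"
      unfolding Inl by (rule G.scc_of_eq[OF G.scc_ofI_reachable[OF G.reachable_adjI]])
    moreover have "G.scc_of (Inr (line_through m f p 0)) \<in> (\<lambda>l. G.scc_of (Inr l)) ` coords m"
      by (rule imageI) simp
    ultimately show ?thesis by (simp only:)
  next
    case (Inr l)
    with v show ?thesis by (auto simp: incidence_graph_def)
  qed
  moreover have "Inr ` coords m \<subseteq> verts (incidence_graph m f)"
    by (auto simp: incidence_graph_def)
  ultimately show ?thesis unfolding G.sccs_verts_conv_scc_of by blast
qed

text \<open>Two weight functions give the same translate exactly when their difference lies in
  \<open>null_weights m f\<close>, so all fibres have the same size.\<close>

lemma card_range_translate:
  "CARD('a) ^ CARD('a) = card (null_weights m f) * card (range (translate m f l))"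
proof -
  have "card (UNIV :: ('a \<Rightarrow> 'a) set) = card (null_weights m f) * card (range (translate m f l))"
  proof (rule card_eq_fibre_times_image)
    fix c :: "'a \<Rightarrow> 'a"
    have eq_iff: "translate m f l d = translate m f l c \<longleftrightarrow> (\<lambda>u. d u - c u) \<in> null_weights m f" for d
    proof -
      have "translate m f l d = translate m f l c \<longleftrightarrow>
          (\<forall>k\<in>{1..m+1}. translate m f l d k = translate m f l c k)"
        by (auto simp: translate_def fun_eq_iff)
      then show ?thesis
        by (simp add: translate_def null_weights_def left_diff_distrib sum_subtractf)
    qed
    show "card {d \<in> UNIV. translate m f l d = translate m f l c} = card (null_weights m f)"
    proof (rule bij_betw_same_card[of "\<lambda>d u. d u - c u"],
        rule bij_betwI[where g = "\<lambda>d u. d u + c u"])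
    qed (auto simp: eq_iff)
  qed simp
  then show ?thesis by (simp add: card_fun)
qed

text \<open>The lines split into cosets of equal size, one per component. Combining this count with
  that of the weights and with \<open>card_null_weights\<close> eliminates the coset size.\<close>

lemma card_sccs: "card G.sccs = card (null_combs m f)"
proof -
  have nonzero: "card (null_weights m f) \<noteq> 0"
    using card_range_translate[of "\<lambda>_. 0"] by (intro notI) simp
  have "card (coords m :: (nat \<Rightarrow> 'a) set) =
      card (range (translate m f (\<lambda>_. 0))) * card ((\<lambda>l. G.scc_of (Inr l)) ` coords m)"
  proof (rule card_eq_fibre_times_image[OF finite_coords])
    fix l :: "nat \<Rightarrow> 'a" assume "l \<in> coords m"
    then have "{l' \<in> coords m. G.scc_of (Inr l') = G.scc_of (Inr l)} = range (translate m f l)"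
      using scc_of_line_eq_iff translate_in_coords by blast
    moreover have "card (range (translate m f l)) = card (range (translate m f (\<lambda>_. 0)))"
      using card_range_translate[of l] card_range_translate[of "\<lambda>_. 0"] nonzero
      by (metis mult_left_cancel)
    ultimately show "card {l' \<in> coords m. G.scc_of (Inr l') = G.scc_of (Inr l)} =
        card (range (translate m f (\<lambda>_. 0)))" by (simp only:)
  qed
  then have eq: "CARD('a) ^ (m + 1) = card (range (translate m f (\<lambda>_. 0))) * card G.sccs"
    by (simp only: card_coords G.card_sccs_verts flip: sccs_verts_eq)
  have "CARD('a) ^ CARD('a) * card G.sccs = CARD('a) ^ (m + 1) * card (null_weights m f)"
    unfolding eq card_range_translate[of "\<lambda>_. 0"] by (simp only: mult_ac)
  also have "\<dots> = CARD('a) ^ CARD('a) * card (null_combs m f)"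
    by (rule card_null_weights)
  finally show ?thesis by simp
qed

text \<open>\<open>connected\<close> refers to the symmetric closure, which for a symmetric digraph
  has the same reachability.\<close>

lemma connected_iff_card_sccs: "connected (incidence_graph m f) \<longleftrightarrow> card G.sccs = 1"
proof -
  have "connected (incidence_graph m f) \<longleftrightarrow> strongly_connected (with_proj (incidence_graph m f))"
    unfolding connected_def strongly_connected_def
    by (simp add: G.reachable_mk_symmetric_eq G.sym_arcs)
  also have "\<dots> \<longleftrightarrow> card G.sccs = 1"
  proof
    assume "card G.sccs = 1"
    then obtain S where S: "G.sccs_verts = {S}"
      by (auto simp: card_1_singleton_iff simp flip: G.card_sccs_verts)
    then have "G.scc_of v = S" if "v \<in> verts (incidence_graph m f)" for v
      using G.scc_of_in_sccs_verts[OF that] by simp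
    then have "u \<rightarrow>\<^sup>*\<^bsub>incidence_graph m f\<^esub> v"
      if "u \<in> verts (incidence_graph m f)" "v \<in> verts (incidence_graph m f)" for u v
    proof -
      have "v \<in> G.scc_of u"
        using \<open>\<And>v. v \<in> verts (incidence_graph m f) \<Longrightarrow> G.scc_of v = S\<close> that
          G.in_scc_of_self[OF that(2)] by (simp only:)
      then have "u \<rightarrow>\<^sup>*\<^bsub>incidence_graph m f\<^esub> v \<and> v \<rightarrow>\<^sup>*\<^bsub>incidence_graph m f\<^esub> u"
        by (simp only: G.scc_of_def mem_Collect_eq)
      then show ?thesis by (rule conjunct1)
    qed
    moreover have "verts (incidence_graph m f) \<noteq> {}"
    proof -
      have "Inr (point_on m f (\<lambda>_. 0) 0) \<in> verts (incidence_graph m f)"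
        by (simp add: incidence_graph_def InrI)
      then show ?thesis by blast
    qed
    ultimately show "strongly_connected (with_proj (incidence_graph m f))"
      unfolding strongly_connected_def by (intro conjI ballI)
  qed (simp add: G.strongly_connected_eq_iff)
  finally show ?thesis .
qed

end

subsection \<open>Spectrum\<close>

definition coord_dot :: "nat \<Rightarrow> (nat \<Rightarrow> 'a::comm_semiring_1) \<Rightarrow> (nat \<Rightarrow> 'a) \<Rightarrow> 'a" where
  "coord_dot m w l = (\<Sum>k=1..m+1. w k * l k)"

text \<open>Pairing \<open>w\<close> with \<open>vartheta m f u\<close> gives
  \<open>lin_comb m f w u\<close>; this brings the zeros of the combination into the
  spectrum.\<close>

lemma coord_dot_line_through_point_on:
  "coord_dot m w (line_through m f (point_on m f l u) t) =
    coord_dot m w l + (t - l 1) * lin_comb m f w u"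
proof -
  have "coord_dot m w (line_through m f (point_on m f l u) t) =
      (\<Sum>k=1..m+1. w k * l k + (t - l 1) * (w k * coord_fun f k u))"
    unfolding coord_dot_def
    by (intro sum.cong refl, subst line_through_point_on) (auto simp: algebra_simps)
  then show ?thesis
    by (simp only: coord_dot_def lin_comb_altdef sum.distrib sum_distrib_left)
qed

text \<open>Entry of \<open>B^T B\<close>, counting the points common to \<open>l\<close> and
  \<open>l'\<close>; a product of indicators matches the block product.\<close>

definition gram :: "nat \<Rightarrow> (nat \<Rightarrow> 'a::{comm_semiring_1,finite} poly) \<Rightarrow> (nat \<Rightarrow> 'a) \<Rightarrow> (nat \<Rightarrow> 'a) \<Rightarrow> complex" where
  "gram m f l l' = (\<Sum>p\<in>coords m. (if incident m f p l then 1 else 0) * (if incident m f p l' then 1 else 0))"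

context additive_character
begin

text \<open>A walk of length two through \<open>u\<close> multiplies the character by
  \<open>\<chi> (s * lin_comb m f w u)\<close> with \<open>s\<close> free; by orthogonality only
  zeros \<open>u\<close> survive, each contributing \<open>CARD('a)\<close>.\<close>

lemma gram_eigenvector:
  fixes f :: "nat \<Rightarrow> 'a poly"
  shows "(\<Sum>l'\<in>coords m. gram m f l l' * \<chi> (coord_dot m w l')) =
    of_nat (CARD('a) * num_zeros m f w) * \<chi> (coord_dot m w l)"
proof -
  have "(\<Sum>l'\<in>coords m. gram m f l l' * \<chi> (coord_dot m w l')) =
      (\<Sum>l'\<in>coords m. \<Sum>p\<in>coords m. if incident m f p l
        then if incident m f p l' then \<chi> (coord_dot m w l') else 0 else 0)"
    unfolding gram_def sum_distrib_right by (intro sum.cong) auto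
  also have "\<dots> = (\<Sum>p\<in>coords m. \<Sum>l'\<in>coords m. if incident m f p l
        then if incident m f p l' then \<chi> (coord_dot m w l') else 0 else 0)"
    by (rule sum.swap)
  also have "\<dots> = (\<Sum>p\<in>coords m. if incident m f p l
        then \<Sum>l'\<in>coords m. if incident m f p l' then \<chi> (coord_dot m w l') else 0 else 0)"
    by (intro sum.cong) auto
  also have "\<dots> = (\<Sum>u\<in>UNIV. \<Sum>t\<in>UNIV. \<chi> (coord_dot m w (line_through m f (point_on m f l u) t)))"
    by (simp only: sum_incident_points sum_incident_lines)
  also have "\<dots> = (\<Sum>u\<in>UNIV. \<chi> (coord_dot m w l) * (\<Sum>t\<in>UNIV. \<chi> ((t - l 1) * lin_comb m f w u)))"
    by (simp only: coord_dot_line_through_point_on chi_add sum_distrib_left)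
  also have "\<dots> = (\<Sum>u\<in>UNIV. \<chi> (coord_dot m w l) *
      (if lin_comb m f w u = 0 then of_nat CARD('a) else 0))"
  proof (intro sum.cong refl arg_cong2[where f = "(*)"])
    fix u
    have "(\<Sum>t\<in>UNIV. \<chi> ((t - l 1) * lin_comb m f w u)) = (\<Sum>x\<in>UNIV. \<chi> (x * lin_comb m f w u))"
      by (rule sum.reindex_bij_witness[of _ "\<lambda>x. x + l 1" "\<lambda>t. t - l 1"]) auto
    then show "(\<Sum>t\<in>UNIV. \<chi> ((t - l 1) * lin_comb m f w u)) =
        (if lin_comb m f w u = 0 then of_nat CARD('a) else 0)"
      by (simp only: sum_chi_mult)
  qed
  also have "\<dots> = \<chi> (coord_dot m w l) * (of_nat (num_zeros m f w) * of_nat CARD('a))"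
    by (simp add: num_zeros_def sum.If_cases flip: sum_distrib_left)
  finally show ?thesis by (simp add: mult.commute)
qed

text \<open>The character table is inverted by its conjugate transpose divided by the group order;
  negating the argument plays the role of conjugation.\<close>

lemma coord_characters_inverse:
  fixes l l' :: "nat \<Rightarrow> 'a"
  assumes "l \<in> coords m" "l' \<in> coords m"
  shows "(\<Sum>w\<in>coords m. \<chi> (coord_dot m w l) * (\<chi> (- coord_dot m w l') / of_nat (CARD('a) ^ (m + 1)))) =
    (if l = l' then 1 else 0)"
proof -
  have "\<chi> (coord_dot m w l) * \<chi> (- coord_dot m w l') = \<chi> (\<Sum>k=1..m+1. w k * (l k - l' k))" for w
    by (simp add: coord_dot_def right_diff_distrib sum_subtractf flip: chi_add del: One_nat_def)
  then have "(\<Sum>w\<in>coords m. \<chi> (coord_dot m w l) * \<chi> (- coord_dot m w l')) =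
      (if \<forall>k\<in>{1..m+1}. l k - l' k = 0 then of_nat (CARD('a) ^ card {1..m+1}) else 0)"
    unfolding coords_def by (simp only: sum_chi_linear_form finite_atLeastAtMost)
  also have "(\<forall>k\<in>{1..m+1}. l k - l' k = 0) \<longleftrightarrow> l = l'"
    using coords_eqI[OF assms] by auto
  finally show ?thesis
    by (simp flip: sum_divide_distrib)
qed

text \<open>The columns of the character table are eigenvectors by \<open>gram_eigenvector\<close>,
  so the table intertwines the kernel with a diagonal one.\<close>

lemma det_gram:
  fixes f :: "nat \<Rightarrow> 'a poly"
  assumes "distinct cs" "set cs = coords m"
  shows "det (kernel_mat cs cs (\<lambda>a b. (if a = b then y else 0) - gram m f a b)) =
    (\<Prod>w\<in>coords m. y - of_nat (CARD('a) * num_zeros m f w))"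
proof -
  let ?d = "\<lambda>w. y - of_nat (CARD('a) * num_zeros m f w)"
  have "det (kernel_mat cs cs (\<lambda>a b. (if a = b then y else 0) - gram m f a b)) =
      det (kernel_mat cs cs (\<lambda>a b. if a = b then ?d a else 0))"
  proof (rule det_kernel_mat_intertwine[where P = "\<lambda>l w. \<chi> (coord_dot m w l)"
        and Q = "\<lambda>w l. \<chi> (- coord_dot m w l) / of_nat (CARD('a) ^ (m + 1))", OF assms(1,1) refl])
    fix l l' assume "l \<in> set cs" "l' \<in> set cs"
    then show "(\<Sum>w\<in>set cs. \<chi> (coord_dot m w l) *
        (\<chi> (- coord_dot m w l') / of_nat (CARD('a) ^ (m + 1)))) = (if l = l' then 1 else 0)"
      unfolding assms(2) by (rule coord_characters_inverse)
  next
    fix l w assume lw: "l \<in> set cs" "w \<in> set cs"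
    have "(\<Sum>l'\<in>set cs. ((if l = l' then y else 0) - gram m f l l') * \<chi> (coord_dot m w l')) =
        (\<Sum>l'\<in>set cs. if l = l' then y * \<chi> (coord_dot m w l') else 0) -
        (\<Sum>l'\<in>coords m. gram m f l l' * \<chi> (coord_dot m w l'))"
      by (simp add: left_diff_distrib sum_subtractf mult_if_zero flip: assms(2))
    also have "\<dots> = \<chi> (coord_dot m w l) * ?d w"
      using lw by (simp add: gram_eigenvector algebra_simps)
    also have "\<dots> = (\<Sum>w'\<in>set cs. \<chi> (coord_dot m w' l) * (if w' = w then ?d w' else 0))"
      using lw by (simp add: mult_if_zero)
    finally show "(\<Sum>l'\<in>set cs. ((if l = l' then y else 0) - gram m f l l') * \<chi> (coord_dot m w l')) =
        (\<Sum>w'\<in>set cs. \<chi> (coord_dot m w' l) * (if w' = w then ?d w' else 0))" .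
  qed
  then show ?thesis
    by (simp only: det_kernel_mat_diagonal[OF assms(1)] assms(2))
qed

end

text \<open>Evaluation at a fixed \<open>x\<close> keeps all determinants over the complex numbers,
  where the characters take their values.\<close>

lemma char_poly_incidence_graph:
  fixes f :: "nat \<Rightarrow> 'a::{field,finite} poly"
  assumes "distinct vs" "set vs = verts (incidence_graph m f)"
  shows "poly (char_poly (adjacency_matrix (incidence_graph m f) vs)) x =
    (\<Prod>w\<in>coords m. x\<^sup>2 - of_nat (CARD('a) * num_zeros m f w))"
proof -
  obtain \<chi> :: "'a \<Rightarrow> complex" where "additive_character \<chi>"
    using ex_additive_character by blast
  then interpret additive_character \<chi> .
  obtain cs :: "(nat \<Rightarrow> 'a) list" where cs: "distinct cs" "set cs = coords m"
    using finite_distinct_list[OF finite_coords] by blast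
  let ?A = "adjacency_matrix (incidence_graph m f) vs"
  let ?adj = "\<lambda>u v. if u \<rightarrow>\<^bsub>incidence_graph m f\<^esub> v then 1 else (0::complex)"
  let ?K = "\<lambda>u v. (if u = v then x else 0) - ?adj u v"
  have "poly (char_poly ?A) x = det (- char_matrix ?A x)"
    by (rule char_poly_matrix[of _ "length vs"]) (simp add: adjacency_matrix_def)
  also have "- char_matrix ?A x = kernel_mat vs vs ?K"
    using assms(1)
    by (intro eq_matI) (auto simp: char_matrix_def adjacency_matrix_def kernel_mat_def nth_eq_iff_index_eq)
  also have "det \<dots> = det (kernel_mat cs cs (\<lambda>a b. (if a = b then x\<^sup>2 else 0)
      - (\<Sum>c\<in>set cs. ?K (Inr a) (Inl c) * ?K (Inl c) (Inr b))))"
  proof (rule det_bipartite_kernel_mat)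
    show "set vs = set cs <+> set cs"
      using assms(2) cs(2) by (simp add: incidence_graph_def)
  qed (use assms(1) cs(1) in \<open>simp_all only: adj_incidence_graph sum.inject if_False diff_zero\<close>)
  \<comment> \<open>Off-diagonal entries are negated adjacency indicators; the two signs cancel in
    the product, leaving \<open>gram\<close>.\<close>
  also have "kernel_mat cs cs (\<lambda>a b. (if a = b then x\<^sup>2 else 0)
      - (\<Sum>c\<in>set cs. ?K (Inr a) (Inl c) * ?K (Inl c) (Inr b))) =
      kernel_mat cs cs (\<lambda>a b. (if a = b then x\<^sup>2 else 0) - gram m f a b)"
    unfolding gram_def cs(2)
    by (intro kernel_mat_cong arg_cong2[where f = "(-)"] refl sum.cong)
      (simp only: adj_incidence_graph cs(2) sum.simps if_False simp_thms diff_0 minus_mult_minus)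
  finally show ?thesis by (simp only: det_gram[OF cs])
qed

section \<open>From the characteristic polynomial to the multiset of eigenvalues\<close>

lemma sum_singleton_mset:
  assumes "finite A"
  shows "(\<Sum>x\<in>A. {#g x#}) = image_mset g (mset_set A)"
  using assms by induction auto

lemma count_image_mset_set:
  assumes "finite A"
  shows "count (image_mset g (mset_set A)) y = card {x \<in> A. g x = y}"
proof -
  have "{x. x \<in># mset_set A \<and> y = g x} = {x \<in> A. g x = y}" using assms by auto
  then show ?thesis using assms by (simp add: count_image_mset' count_mset_set')
qed

text \<open>Each factor of the evaluated characteristic polynomial is a difference of squares.
  Complex polynomials that agree everywhere are equal, so the roots can be read off.\<close>

lemma eigenvalues_incidence_graph:
  fixes f :: "nat \<Rightarrow> 'a::{field,finite} poly"
  assumes "distinct vs" "set vs = verts (incidence_graph m f)"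
  defines "s \<equiv> (\<lambda>w. complex_of_real (sqrt (real (CARD('a) * num_zeros m f w))))"
  shows "eigenvalues_mset (adjacency_matrix (incidence_graph m f) vs) =
    image_mset s (mset_set (coords m)) + image_mset (\<lambda>w. - s w) (mset_set (coords m))"
proof -
  have "x\<^sup>2 - of_nat (CARD('a) * num_zeros m f w) = (x - s w) * (x + s w)" for x w
  proof -
    have "(s w)\<^sup>2 = of_nat (CARD('a) * num_zeros m f w)"
      unfolding s_def of_real_power[symmetric] by (simp only: real_sqrt_pow2 of_nat_0_le_iff of_real_of_nat_eq)
    then show ?thesis by (simp add: algebra_simps power2_eq_square)
  qed
  then have "poly (char_poly (adjacency_matrix (incidence_graph m f) vs)) x =
      poly (\<Prod>w\<in>coords m. [:- s w, 1:] * [:s w, 1:]) x" for x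
    unfolding char_poly_incidence_graph[OF assms(1,2)] poly_prod
    by (intro prod.cong) (auto simp: algebra_simps)
  then have "char_poly (adjacency_matrix (incidence_graph m f) vs) =
      (\<Prod>w\<in>coords m. [:- s w, 1:] * [:s w, 1:])"
    by (intro poly_ext)
  then have "eigenvalues_mset (adjacency_matrix (incidence_graph m f) vs) =
      (\<Sum>w\<in>coords m. {#s w#} + {#- s w#})"
    by (simp add: eigenvalues_mset_def proots_prod proots_mult del: mult_pCons_left mult_pCons_right)
  then show ?thesis
    by (simp only: sum.distrib sum_singleton_mset[OF finite_coords])
qed

theorem theorem2p2:
  fixes f :: "nat \<Rightarrow> 'a::{field,finite} poly" and m q :: nat
  assumes "q = CARD('a)"
    and "m \<ge> 1"
    and "inj (vartheta m f)"
  shows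
    "(\<forall>vs. distinct vs \<and> set vs = verts (incidence_graph m f) \<longrightarrow>
        (let A = adjacency_matrix (incidence_graph m f) vs;
             n = (\<lambda>i. card {w \<in> coords m. num_zeros m f w = i})
         in eigenvalues_mset A =
              image_mset (\<lambda>w. complex_of_real (sqrt (real (q * num_zeros m f w)))) (mset_set (coords m))
              + image_mset (\<lambda>w. - complex_of_real (sqrt (real (q * num_zeros m f w)))) (mset_set (coords m))
          \<and> (\<forall>i\<in>{1..q}.
               count (eigenvalues_mset A) (complex_of_real (sqrt (real (q * i)))) = n i
             \<and> count (eigenvalues_mset A) (- complex_of_real (sqrt (real (q * i)))) = n i)
          \<and> count (eigenvalues_mset A) 0 = 2 * n 0))
     \<and> card (pre_digraph.sccs (incidence_graph m f)) = q ^ (m + 1 - fun_rank m f)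
     \<and> (connected (incidence_graph m f) \<longleftrightarrow> fun_independent m f)"
proof (intro conjI allI impI)
  show "card (pre_digraph.sccs (incidence_graph m f)) = q ^ (m + 1 - fun_rank m f)"
    by (simp only: card_sccs card_null_combs_rank assms(1))
  show "connected (incidence_graph m f) \<longleftrightarrow> fun_independent m f"
    by (simp only: connected_iff_card_sccs card_sccs card_null_combs_eq_1_iff)
next
  fix vs assume vs: "distinct vs \<and> set vs = verts (incidence_graph m f)"
  define A where "A = adjacency_matrix (incidence_graph m f) vs"
  define s where "s = (\<lambda>i. complex_of_real (sqrt (real (q * i))))"
  define n where "n = (\<lambda>i. card {w \<in> coords m. num_zeros m f w = i})"
  have q: "q > 0" using assms(1) by simp
  have s_eq: "s i = s j \<longleftrightarrow> i = j" for i j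
    using q by (simp add: s_def)
  \<comment> \<open>The two families of roots meet only at 0, so for positive \<open>i\<close> each
    sign is counted by one family alone.\<close>
  have s_neg: "- s i = s j \<longleftrightarrow> i = 0 \<and> j = 0" for i j
  proof -
    have "- s i = s j \<longleftrightarrow> sqrt (real (q * i)) + sqrt (real (q * j)) = 0"
      unfolding s_def of_real_minus[symmetric] of_real_eq_iff by linarith
    also have "\<dots> \<longleftrightarrow> i = 0 \<and> j = 0"
      using q by (simp add: add_nonneg_eq_0_iff)
    finally show ?thesis .
  qed
  have mset: "eigenvalues_mset A = image_mset (\<lambda>w. s (num_zeros m f w)) (mset_set (coords m))
      + image_mset (\<lambda>w. - s (num_zeros m f w)) (mset_set (coords m))"
    unfolding A_def s_def assms(1) using vs by (intro eigenvalues_incidence_graph) auto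
  have count: "count (eigenvalues_mset A) z = card {w \<in> coords m. s (num_zeros m f w) = z}
      + card {w \<in> coords m. - s (num_zeros m f w) = z}" for z
    unfolding mset count_union by (simp only: count_image_mset_set[OF finite_coords])
  have pos: "count (eigenvalues_mset A) (s i) = n i" "count (eigenvalues_mset A) (- s i) = n i"
    if "i \<noteq> 0" for i
  proof -
    show "count (eigenvalues_mset A) (s i) = n i"
      unfolding count n_def using that by (simp add: s_eq s_neg)
    have "s j = - s i \<longleftrightarrow> False" for j using s_neg[of i j] that by auto
    then show "count (eigenvalues_mset A) (- s i) = n i"
      unfolding count n_def by (simp add: s_eq)
  qed
  \<comment> \<open>At 0 both families contribute, which doubles the count.\<close>
  have "s i = 0 \<longleftrightarrow> i = 0" for i using s_eq[of i 0] by (simp add: s_def)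
  then have zero: "count (eigenvalues_mset A) 0 = 2 * n 0"
    unfolding count n_def by simp
  show "let A = adjacency_matrix (incidence_graph m f) vs;
             n = (\<lambda>i. card {w \<in> coords m. num_zeros m f w = i})
         in eigenvalues_mset A =
              image_mset (\<lambda>w. complex_of_real (sqrt (real (q * num_zeros m f w)))) (mset_set (coords m))
              + image_mset (\<lambda>w. - complex_of_real (sqrt (real (q * num_zeros m f w)))) (mset_set (coords m))
          \<and> (\<forall>i\<in>{1..q}.
               count (eigenvalues_mset A) (complex_of_real (sqrt (real (q * i)))) = n i
             \<and> count (eigenvalues_mset A) (- complex_of_real (sqrt (real (q * i)))) = n i)
          \<and> count (eigenvalues_mset A) 0 = 2 * n 0"
    unfolding Let_def A_def[symmetric]
    using mset pos zero unfolding s_def n_def by auto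
qed

end
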